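(* Let $\sigma>2$ be an integer, $\rho$ an integer relatively prime to $\sigma$, $\theta=2\rho\pi/\sigma$, $\omega=e^{i\theta}$, and $G$ a matrix over $\mathrm{GF}(2)$ of rank $r$ with column set $E$. For $k=0,\dots,\sigma-1$ let $\mathcal{T}(k,\sigma)$ be the set of triples $(f_1,f_2,f_3)$ of functions $f_j:E\to\mathrm{GF}(2)$ such that $f_1-f_2$ and $f_2-f_3$ lie in the row space of $G$ over $\mathrm{GF}(2)$ and $|\mathrm{supp}(f_1)|+|\mathrm{supp}(f_2)|+|\mathrm{supp}(f_3)|\equiv k\pmod\sigma$. Then $$\sum_{k=0}^{\sigma-1}\omega^k|\mathcal{T}(k,\sigma)| = \omega^{|E|-r}(1+\omega)^{|E|}(1-\omega)^{2r}R\!\left(M(G);\frac{2}{\cos\theta-1},2(\cos\theta-1)\right).$$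
   Context: $i=\sqrt{-1}$; $\mathrm{supp}(f)=\{e: f(e)\ne0\}$. $M(G)$ is the matroid on $E$ of linear dependence of the columns of $G$, with rank function $\mathrm{rk}$ and rank $r$; $R(M;\lambda,x)=\sum_{B\subseteq E}\lambda^{r-\mathrm{rk}(B)}x^{|B|-\mathrm{rk}(B)}$. *)

theory Defs
  imports Complex_Main "HOL-Library.Z2" "HOL-Number_Theory.Cong" "Jordan_Normal_Form.DL_Rank"
begin

text \<open>A matroid is presented by its finite ground set and its family of independent sets;
  the record itself does not impose the matroid axioms.\<close>

record 'e matroid =
  ground :: "'e set"
  indeps :: "'e set set"

definition matroid_rank :: "'e matroid \<Rightarrow> 'e set \<Rightarrow> nat" where
  "matroid_rank M B = Max (card ` {I \<in> indeps M. I \<subseteq> B})"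

text \<open>Both subtractions are between naturals but never truncate, since
  \<open>rk B \<le> rk E\<close> and \<open>rk B \<le> |B|\<close> for \<open>B \<subseteq> E\<close>.\<close>

definition rank_generating :: "'e matroid \<Rightarrow> 'a::comm_semiring_1 \<Rightarrow> 'a \<Rightarrow> 'a" where
  "rank_generating M l x =
     (\<Sum>B\<in>Pow (ground M).
        l ^ (matroid_rank M (ground M) - matroid_rank M B) * x ^ (card B - matroid_rank M B))"

text \<open>The elements of the matroid of a matrix are the column \<^emph>\<open>indices\<close>, so that equal columns
  are parallel elements. A family of columns is linearly independent iff the columns are
  pairwise distinct and form a linearly independent set; hence the injectivity condition.\<close>

definition column_matroid :: "'a::field mat \<Rightarrow> nat matroid" where
  "column_matroid A =
     \<lparr>ground = {0..<dim_col A},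
      indeps = {I. I \<subseteq> {0..<dim_col A} \<and> inj_on (col A) I \<and>
                \<not> module.lin_dep class_ring (module_vec TYPE('a) (dim_row A)) (col A ` I)}\<rparr>"

text \<open>Functions from the column set \<open>E = {0..<n}\<close> to the field are vectors of dimension \<open>n\<close>.\<close>

definition supp :: "'a::zero vec \<Rightarrow> nat set" where
  "supp f = {e. e < dim_vec f \<and> f $ e \<noteq> 0}"

abbreviation row_space :: "'a::field mat \<Rightarrow> 'a vec set" where
  "row_space A \<equiv> vec_space.row_space (dim_col A) A"

definition triples :: "bit mat \<Rightarrow> nat \<Rightarrow> nat \<Rightarrow> (bit vec \<times> bit vec \<times> bit vec) set" where
  "triples G k \<sigma> =
     {(f1, f2, f3).
        f1 \<in> carrier_vec (dim_col G) \<and> f2 \<in> carrier_vec (dim_col G) \<and> f3 \<in> carrier_vec (dim_col G) \<and>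
        f1 - f2 \<in> row_space G \<and> f2 - f3 \<in> row_space G \<and>
        [card (supp f1) + card (supp f2) + card (supp f3) = k] (mod \<sigma>)}"

end

theory Submission
  imports Defs
begin

text \<open>
  Since \<open>\<omega>\<^sup>\<sigma> = 1\<close>, the left-hand side is the sum of \<open>\<omega>\<close> to the total weight over all triples
  \<open>(f + u, f, f + v)\<close> with \<open>u\<close>, \<open>v\<close> in the row space. Summing over \<open>f\<close> factors over the coordinates
  \<open>e\<close>: the factor is \<open>1 + \<omega>\<^sup>3 = (1 + \<omega>)(\<omega> + (1 - \<omega>)\<^sup>2)\<close> if \<open>u\<close> and \<open>v\<close> both vanish at \<open>e\<close>, and
  \<open>\<omega> + \<omega>\<^sup>2 = (1 + \<omega>) \<omega>\<close> otherwise. Expanding the product over sets \<open>A\<close> of coordinates leaves the number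
  of pairs \<open>(u, v)\<close> vanishing on \<open>A\<close>, which is \<open>4\<close> to the power \<open>r - rk A\<close>. The result matches the
  rank generating polynomial because \<open>2 (cos \<theta> - 1) \<omega> = (1 - \<omega>)\<^sup>2\<close>.
\<close>

section \<open>Sums over binary vectors\<close>

lemma UNIV_bit: "(UNIV :: bit set) = {0, 1}"
  using bit_not_zero_iff by blast

text \<open>Carries sums over vectors to sums over extensional functions, the setting of
  \<open>prod_sum_PiE\<close>.\<close>

lemma bij_betw_vec_PiE: "bij_betw (vec n) (PiE {0..<n} (\<lambda>_. UNIV)) (carrier_vec n)"
proof (rule bij_betw_byWitness[where f' = "\<lambda>v. restrict (($) v) {0..<n}"])
  show "\<forall>f\<in>PiE {0..<n} (\<lambda>_. UNIV). restrict (($) (vec n f)) {0..<n} = f"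
    by (auto simp: fun_eq_iff restrict_def PiE_def extensional_def)
qed auto

lemma finite_carrier_vec_bit: "finite (carrier_vec n :: bit vec set)"
  using bij_betw_finite[OF bij_betw_vec_PiE[of n, where 'a = bit]]
  by (simp add: finite_PiE UNIV_bit)

text \<open>The coordinates of \<open>f\<close> are chosen independently, so distributivity applies.
  It serves both the character sums and the weight enumerator.\<close>

lemma sum_carrier_vec_prod:
  fixes g :: "nat \<Rightarrow> bit \<Rightarrow> 'b::comm_semiring_1"
  shows "(\<Sum>f\<in>carrier_vec n. \<Prod>e = 0..<n. g e (f $ e)) = (\<Prod>e = 0..<n. g e 0 + g e 1)"
proof -
  have "(\<Prod>e = 0..<n. g e 0 + g e 1) = (\<Prod>e = 0..<n. \<Sum>b\<in>UNIV. g e b)"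
    by (simp add: UNIV_bit)
  also have "\<dots> = (\<Sum>h\<in>PiE {0..<n} (\<lambda>_. UNIV). \<Prod>e = 0..<n. g e (h e))"
    by (rule prod_sum_PiE) (auto simp: UNIV_bit)
  also have "\<dots> = (\<Sum>h\<in>PiE {0..<n} (\<lambda>_. UNIV). \<Prod>e = 0..<n. g e (vec n h $ e))"
    by simp
  also have "\<dots> = (\<Sum>f\<in>carrier_vec n. \<Prod>e = 0..<n. g e (f $ e))"
    by (rule sum.reindex_bij_betw[OF bij_betw_vec_PiE])
  finally show ?thesis ..
qed

lemma card_supp_power:
  fixes x :: "'b::comm_semiring_1" and f :: "bit vec"
  assumes "f \<in> carrier_vec n"
  shows "x ^ card (supp f) = (\<Prod>e = 0..<n. if f $ e = 0 then 1 else x)"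
proof -
  have "supp f = {e \<in> {0..<n}. f $ e \<noteq> 0}"
    using assms by (auto simp: supp_def)
  then have "x ^ card (supp f) = (\<Prod>e\<in>{e \<in> {0..<n}. f $ e \<noteq> 0}. x)"
    by simp
  also have "\<dots> = (\<Prod>e = 0..<n. if f $ e \<noteq> 0 then x else 1)"
    by (rule prod.inter_filter) simp
  also have "\<dots> = (\<Prod>e = 0..<n. if f $ e = 0 then 1 else x)"
    by (rule prod.cong) auto
  finally show ?thesis .
qed

section \<open>Annihilators of sets of binary vectors\<close>

text \<open>The nontrivial additive character of GF(2), with integer values so that its sums can
  count.\<close>

definition bit_sign :: "bit \<Rightarrow> int" where
  "bit_sign b = (if b = 0 then 1 else - 1)"

lemma bit_sign_0 [simp]: "bit_sign 0 = 1" and bit_sign_1 [simp]: "bit_sign 1 = - 1"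
  by (simp_all add: bit_sign_def)

lemma bit_sign_sum: "bit_sign (\<Sum>i\<in>A. f i) = (\<Prod>i\<in>A. bit_sign (f i))"
proof -
  have add: "bit_sign (a + b) = bit_sign a * bit_sign b" for a b
    by (cases a; cases b) auto
  show ?thesis
    by (induction A rule: infinite_finite_induct) (simp_all only: sum.infinite prod.infinite
      sum.empty prod.empty sum.insert prod.insert add bit_sign_0 simp_thms)
qed

text \<open>Orthogonality of characters: a nonzero coordinate of \<open>v\<close> gives a factor 1 -
  1, while for zero \<open>v\<close> every factor is 2.\<close>

lemma sum_bit_sign_scalar_prod:
  assumes "v \<in> carrier_vec m"
  shows "(\<Sum>x\<in>carrier_vec m. bit_sign (x \<bullet> v)) = (if v = 0\<^sub>v m then 2 ^ m else 0)"
proof -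
  have "(\<Sum>x\<in>carrier_vec m. bit_sign (x \<bullet> v)) =
      (\<Sum>x\<in>carrier_vec m. \<Prod>i = 0..<m. bit_sign (x $ i * v $ i))"
    using assms by (simp only: scalar_prod_def bit_sign_sum carrier_vecD)
  also have "\<dots> = (\<Prod>i = 0..<m. 1 + bit_sign (v $ i))"
    by (subst sum_carrier_vec_prod) (simp only: mult_zero_left mult_1 bit_sign_0)
  also have "\<dots> = (if v = 0\<^sub>v m then 2 ^ m else 0)"
  proof (cases "v = 0\<^sub>v m")
    case False
    then obtain i where "i < m" "v $ i \<noteq> 0"
      using assms by (metis carrier_vecD eq_vecI index_zero_vec)
    then show ?thesis
      using False by (auto intro!: bexI[of _ i] simp: prod_zero_iff bit_sign_def)
  qed simp
  finally show ?thesis .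
qed

text \<open>If \<open>S\<close> consists of the columns of a matrix indexed by \<open>A\<close>,
  these are the coefficient vectors whose combination of the rows vanishes on
  \<open>A\<close>.\<close>

definition annihilator :: "nat \<Rightarrow> 'a::semiring_0 vec set \<Rightarrow> 'a vec set" where
  "annihilator m S = {x \<in> carrier_vec m. \<forall>v\<in>S. x \<bullet> v = 0}"

lemma finite_annihilator_bit: "finite (annihilator m (S :: bit vec set))"
  by (simp add: annihilator_def finite_carrier_vec_bit)

text \<open>Evaluate the sum of \<open>(-1)\<^bsup>x \<bullet> \<Sum>B\<^esup>\<close> over all vectors \<open>x\<close> and all \<open>B \<subseteq> S\<close> in both orders:
  independence leaves only \<open>B = {}\<close>, and for fixed \<open>x\<close> the sum is \<open>\<Prod>v\<in>S. 1 + (-1)\<^bsup>x \<bullet> v\<^esup>\<close>.\<close>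

lemma card_annihilator_lin_indpt:
  fixes S :: "bit vec set"
  assumes S: "S \<subseteq> carrier_vec m"
    and indpt: "\<not> module.lin_dep class_ring (module_vec TYPE(bit) m) S"
  shows "card (annihilator m S) * 2 ^ card S = 2 ^ m"
proof -
  interpret V: vec_space "TYPE(bit)" m .
  have fin: "finite S"
    using S finite_carrier_vec_bit finite_subset by blast
  \<comment> \<open>The sum of the vectors in \<open>B\<close>, written as a linear combination with
    all coefficients 1 so that independence applies to it directly.\<close>
  define s where "s B = V.lincomb (\<lambda>_. 1) B" for B
  have s_carrier: "s B \<in> carrier_vec m" if "B \<subseteq> S" for B
    unfolding s_def using that S by (intro V.lincomb_closed) auto
  have s_index: "s B $ i = (\<Sum>v\<in>B. v $ i)" if "B \<subseteq> S" "i < m" for B i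
    unfolding s_def using V.lincomb_index[of i B "\<lambda>_. 1"] that S by (simp only: mult_1 order.trans)
  have s_zero: "s B = 0\<^sub>v m \<longleftrightarrow> B = {}" if B: "B \<subseteq> S" for B
  proof
    assume "s B = 0\<^sub>v m"
    then show "B = {}"
      using indpt V.lin_dep_crit[where A = B and S = S and a = "\<lambda>_. 1"] B fin finite_subset
      unfolding s_def by fastforce
  qed (simp add: s_def V.lincomb_def)
  have s_prod: "bit_sign (x \<bullet> s B) = (\<Prod>v\<in>B. bit_sign (x \<bullet> v))"
    if x: "x \<in> carrier_vec m" and B: "B \<subseteq> S" for x B
  proof -
    have "x \<bullet> s B = (\<Sum>i = 0..<m. x $ i * s B $ i)"
      using s_carrier[OF B] by (simp add: scalar_prod_def)
    also have "\<dots> = (\<Sum>i = 0..<m. \<Sum>v\<in>B. x $ i * v $ i)"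
      by (rule sum.cong) (auto simp only: s_index[OF B] atLeastLessThan_iff sum_distrib_left)
    also have "\<dots> = (\<Sum>v\<in>B. \<Sum>i = 0..<m. x $ i * v $ i)"
      by (rule sum.swap)
    also have "\<dots> = (\<Sum>v\<in>B. x \<bullet> v)"
      using B S by (intro sum.cong) (auto simp: scalar_prod_def)
    finally show ?thesis
      by (simp add: bit_sign_sum)
  qed
  have "(\<Sum>x\<in>carrier_vec m. \<Sum>B\<in>Pow S. bit_sign (x \<bullet> s B)) =
      (\<Sum>B\<in>Pow S. \<Sum>x\<in>carrier_vec m. bit_sign (x \<bullet> s B))"
    by (rule sum.swap)
  also have "\<dots> = (\<Sum>B\<in>Pow S. if B = {} then 2 ^ m else 0)"
    by (intro sum.cong) (auto simp: sum_bit_sign_scalar_prod s_carrier s_zero)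
  also have "\<dots> = 2 ^ m"
    using fin by (simp add: sum.delta)
  finally have "(\<Sum>x\<in>carrier_vec m. \<Sum>B\<in>Pow S. bit_sign (x \<bullet> s B)) = 2 ^ m" .
  moreover have "(\<Sum>B\<in>Pow S. bit_sign (x \<bullet> s B)) =
      (if x \<in> annihilator m S then 2 ^ card S else 0)" if x: "x \<in> carrier_vec m" for x
  proof -
    have "(\<Sum>B\<in>Pow S. bit_sign (x \<bullet> s B)) = (\<Sum>B\<in>Pow S. \<Prod>v\<in>B. bit_sign (x \<bullet> v))"
      by (rule sum.cong) (auto simp: s_prod[OF x])
    also have "\<dots> = (\<Prod>v\<in>S. bit_sign (x \<bullet> v) + 1)"
      using fin by (simp add: prod_add)
    also have "\<dots> = (if x \<in> annihilator m S then 2 ^ card S else 0)"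
      using x fin by (auto simp: annihilator_def prod_zero_iff bit_sign_def)
    finally show ?thesis .
  qed
  ultimately have "(\<Sum>x\<in>carrier_vec m. if x \<in> annihilator m S then 2 ^ card S else 0) = (2 ^ m :: int)"
    by simp
  moreover have "{x \<in> carrier_vec m. x \<in> annihilator m S} = annihilator m S"
    by (auto simp: annihilator_def)
  ultimately have "int (card (annihilator m S) * 2 ^ card S) = int (2 ^ m)"
    using finite_carrier_vec_bit[of m] by (simp add: sum.If_cases Int_def)
  then show ?thesis
    by (simp only: of_nat_eq_iff)
qed

text \<open>By maximality \<open>S\<close> spans \<open>T\<close>: a vector of \<open>T\<close>
  outside the span could be added to \<open>S\<close>. A vector orthogonal to \<open>S\<close> is
  orthogonal to its span, hence to \<open>T\<close>.\<close>

lemma annihilator_eq_if_maximal: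
  fixes T :: "'a::field vec set"
  assumes T: "T \<subseteq> carrier_vec m"
    and "maximal S (\<lambda>S. S \<subseteq> T \<and> \<not> module.lin_dep class_ring (module_vec TYPE('a) m) S)"
  shows "annihilator m S = annihilator m T"
proof -
  interpret V: vec_space "TYPE('a)" m .
  have S: "S \<subseteq> T" and indpt: "V.lin_indpt S"
    and max: "\<And>S'. S \<subseteq> S' \<Longrightarrow> S' \<subseteq> T \<Longrightarrow> V.lin_indpt S' \<Longrightarrow> S' = S"
    using assms(2) by (auto simp: maximal_def)
  have "T \<subseteq> V.span S"
  proof
    fix v assume v: "v \<in> T"
    show "v \<in> V.span S"
    proof (rule ccontr)
      assume nspan: "v \<notin> V.span S"
      then have "v \<notin> S"
        using V.span_mem[of S v] S T by auto
      then have "V.lin_indpt (insert v S)"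
        using V.lin_dep_iff_in_span[of S v] S T v indpt nspan by auto
      then show False
        using max[of "insert v S"] \<open>v \<notin> S\<close> S v by auto
    qed
  qed
  then have "V.orthogonal_complement (V.span S) \<subseteq> V.orthogonal_complement T"
    by (rule V.orthogonal_complement_subset)
  moreover have "V.orthogonal_complement (V.span S) = V.orthogonal_complement S"
    using S T by (intro V.in_orthogonal_complement_span) auto
  ultimately have "annihilator m S \<subseteq> annihilator m T"
    by (simp add: V.orthogonal_complement_def annihilator_def)
  then show ?thesis
    using S by (auto simp: annihilator_def)
qed

section \<open>The rank function of the column matroid\<close>

text \<open>An independent set of maximum cardinality is maximal under inclusion. This passes from
  sets of column indices to sets of vectors.\<close>

lemma column_matroid_maximal:
  fixes G :: "'a::field mat"
  assumes G: "G \<in> carrier_mat m n" and A: "A \<subseteq> {0..<n}"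
  obtains S where
    "maximal S (\<lambda>S. S \<subseteq> col G ` A \<and> \<not> module.lin_dep class_ring (module_vec TYPE('a) m) S)"
    "card S = matroid_rank (column_matroid G) A"
proof -
  interpret V: vec_space "TYPE('a)" m .
  let ?F = "{I \<in> indeps (column_matroid G). I \<subseteq> A}"
  have indeps: "I \<in> indeps (column_matroid G) \<longleftrightarrow>
      I \<subseteq> {0..<n} \<and> inj_on (col G) I \<and> V.lin_indpt (col G ` I)" for I
    using G by (auto simp: column_matroid_def)
  have finA: "finite A"
    using A finite_subset by blast
  then have fin: "finite ?F"
    by (rule_tac finite_subset[of _ "Pow A"]) auto
  have "{} \<in> ?F"
    unfolding indeps mem_Collect_eq by (auto simp: V.lin_dep_def)
  then have "Max (card ` ?F) \<in> card ` ?F"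
    using fin by (intro Max_in) auto
  then obtain I where I: "I \<in> ?F" and rank: "card I = matroid_rank (column_matroid G) A"
    by (auto simp: matroid_rank_def)
  have inj: "inj_on (col G) I" and indpt: "V.lin_indpt (col G ` I)" and IA: "I \<subseteq> A"
    using I indeps by auto
  have "S = col G ` I"
    if le: "col G ` I \<subseteq> S" and SA: "S \<subseteq> col G ` A" and S: "V.lin_indpt S" for S
  proof -
    \<comment> \<open>One index is chosen for each column in \<open>S\<close>, so that
      \<open>J\<close> is independent in the matroid even if columns repeat.\<close>
    obtain J where J: "J \<subseteq> A" "inj_on (col G) J" "S = col G ` J"
      using SA subset_image_inj[of S "col G" A] by metis
    then have "J \<in> ?F"
      using A S indeps by auto
    then have "card J \<le> card I"
      unfolding rank matroid_rank_def using fin by (intro Max_ge) auto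
    then have "card S \<le> card (col G ` I)"
      using J inj by (simp add: card_image)
    moreover have "finite S"
      using SA finA finite_surj by blast
    ultimately show ?thesis
      using le card_seteq by metis
  qed
  then have "maximal (col G ` I) (\<lambda>S. S \<subseteq> col G ` A \<and> V.lin_indpt S)"
    using IA indpt by (auto simp: maximal_def)
  then show thesis
    using that rank card_image[OF inj] by metis
qed

lemma matroid_rank_column_matroid:
  fixes G :: "'a::field mat"
  assumes G: "G \<in> carrier_mat m n"
  shows "matroid_rank (column_matroid G) {0..<n} = vec_space.rank m G"
proof -
  have "col G ` {0..<n} = set (cols G)"
    using G by (auto simp: cols_def)
  then show ?thesis
    using column_matroid_maximal[OF G order.refl] vec_space.rank_card_indpt[OF G] by metis
qed

text \<open>Keeps the natural subtractions in the exponents from truncating.\<close>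

lemma matroid_rank_column_matroid_le_card:
  fixes G :: "'a::field mat"
  assumes G: "G \<in> carrier_mat m n" and A: "A \<subseteq> {0..<n}"
  shows "matroid_rank (column_matroid G) A \<le> card A"
proof -
  obtain S where S: "S \<subseteq> col G ` A" "card S = matroid_rank (column_matroid G) A"
    using column_matroid_maximal[OF G A] unfolding maximal_def by metis
  have "finite A"
    using A finite_subset by blast
  then show ?thesis
    using S surj_card_le by metis
qed

text \<open>Rank-nullity in counting form: a maximal independent set of the chosen columns has the
  same annihilator, which reduces to the independent case.\<close>

lemma card_annihilator_cols:
  fixes G :: "bit mat"
  assumes G: "G \<in> carrier_mat m n" and A: "A \<subseteq> {0..<n}"
  shows "card (annihilator m (col G ` A)) * 2 ^ matroid_rank (column_matroid G) A = 2 ^ m"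
proof -
  obtain S where max: "maximal S (\<lambda>S. S \<subseteq> col G ` A \<and>
        \<not> module.lin_dep class_ring (module_vec TYPE(bit) m) S)"
    and card: "card S = matroid_rank (column_matroid G) A"
    using column_matroid_maximal[OF G A] by metis
  have T: "col G ` A \<subseteq> carrier_vec m"
    using G by auto
  then have "card (annihilator m S) * 2 ^ card S = 2 ^ m"
    using max by (intro card_annihilator_lin_indpt) (auto simp: maximal_def)
  then show ?thesis
    using annihilator_eq_if_maximal[OF T max] card by simp
qed

section \<open>Codewords vanishing on a set of coordinates\<close>

text \<open>The linear map \<open>\<phi>\<close> sends the annihilator of the columns in
  \<open>A\<close> onto the codewords vanishing on \<open>A\<close>, and every fiber is a translate
  of the kernel \<open>K\<close>. Both annihilators are counted by ranks, and their quotient is the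
  claim.\<close>

lemma card_row_space_vanishing:
  fixes G :: "bit mat"
  assumes G: "G \<in> carrier_mat m n" and A: "A \<subseteq> {0..<n}"
  shows "matroid_rank (column_matroid G) A \<le> matroid_rank (column_matroid G) {0..<n}"
    and "card {u \<in> row_space G. \<forall>e\<in>A. u $ e = 0} =
      2 ^ (matroid_rank (column_matroid G) {0..<n} - matroid_rank (column_matroid G) A)"
proof -
  let ?rk = "matroid_rank (column_matroid G)"
  define \<phi> where "\<phi> x = G\<^sup>T *\<^sub>v x" for x
  define K where "K = annihilator m (col G ` {0..<n})"
  have row_space: "row_space G = \<phi> ` carrier_vec m"
    using G vec_space.row_space_eq[of G m "dim_col G"] by (auto simp: \<phi>_def)
  have \<phi>_index: "\<phi> x $ e = x \<bullet> col G e" if "x \<in> carrier_vec m" "e < n" for x e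
    using that G by (simp add: \<phi>_def comm_scalar_prod[of _ m])
  have dim_\<phi>: "dim_vec (\<phi> x) = n" for x
    using G by (simp add: \<phi>_def)
  have \<phi>_add: "\<phi> (x + y) = \<phi> x + \<phi> y" if "x \<in> carrier_vec m" "y \<in> carrier_vec m" for x y
    using that G unfolding \<phi>_def by (intro mult_add_distrib_mat_vec) auto
  have K: "K = {x \<in> carrier_vec m. \<phi> x = 0\<^sub>v n}"
    by (auto simp: K_def annihilator_def \<phi>_index vec_eq_iff dim_\<phi>)
  have fiber: "card {x \<in> carrier_vec m. \<phi> x = u} = card K" if u_row: "u \<in> row_space G" for u
  proof -
    obtain x0 where x0: "x0 \<in> carrier_vec m" "u = \<phi> x0"
      using u_row row_space by auto
    \<comment> \<open>In characteristic 2, translation by \<open>x0\<close> is its own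
      inverse.\<close>
    have cancel: "x0 + (x0 + x) = x" if "x \<in> carrier_vec m" for x
    proof (rule eq_vecI)
      fix i assume "i < dim_vec x"
      then show "(x0 + (x0 + x)) $ i = x $ i"
        using x0 that by (cases "x0 $ i"; cases "x $ i") auto
    qed (use x0 that in auto)
    have u: "u + u = 0\<^sub>v n"
      using x0 dim_\<phi> by (auto simp: vec_eq_iff)
    have u0: "u + 0\<^sub>v n = u"
      using x0 dim_\<phi> by (auto simp: vec_eq_iff)
    have "bij_betw ((+) x0) K {x \<in> carrier_vec m. \<phi> x = u}"
      by (rule bij_betw_byWitness[where f' = "(+) x0"])
        (use x0 u u0 in \<open>auto simp: K cancel \<phi>_add\<close>)
    then show ?thesis
      by (metis bij_betw_same_card)
  qed
  let ?C = "{u \<in> row_space G. \<forall>e\<in>A. u $ e = 0}"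
  have "\<phi> ` annihilator m (col G ` A) = ?C"
    using A by (auto simp: annihilator_def row_space \<phi>_index subset_iff image_iff)
  moreover have "card (annihilator m (col G ` A)) =
      (\<Sum>u\<in>\<phi> ` annihilator m (col G ` A). card {x \<in> annihilator m (col G ` A). \<phi> x = u})"
    using sum.image_gen[of "annihilator m (col G ` A)" "\<lambda>_. 1 :: nat" \<phi>]
      finite_annihilator_bit by simp
  \<comment> \<open>Membership in the annihilator depends only on \<open>\<phi> x\<close>, so it
    contains whole fibers.\<close>
  moreover have "{x \<in> annihilator m (col G ` A). \<phi> x = u} = {x \<in> carrier_vec m. \<phi> x = u}"
    if "u \<in> ?C" for u
    using A that by (auto simp: annihilator_def \<phi>_index subset_iff)
  ultimately have "card (annihilator m (col G ` A)) = card ?C * card K"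
    by (simp add: fiber)
  then have C: "card ?C * card K * 2 ^ ?rk A = card K * 2 ^ ?rk {0..<n}"
    using card_annihilator_cols[OF G A] card_annihilator_cols[OF G order.refl]
    by (simp add: K_def)
  have "card K \<noteq> 0"
    using card_annihilator_cols[OF G order.refl] by (metis K_def mult_0 power_not_zero zero_neq_numeral)
  then have *: "card ?C * 2 ^ ?rk A = 2 ^ ?rk {0..<n}"
    using C by simp
  \<comment> \<open>Monotonicity of the rank is read off from divisibility between powers of
    two.\<close>
  then have "(2 :: nat) ^ ?rk A dvd 2 ^ ?rk {0..<n}"
    unfolding *[symmetric] by simp
  then show le: "?rk A \<le> ?rk {0..<n}"
    by (simp add: power_dvd_imp_le)
  have "card ?C * 2 ^ ?rk A = 2 ^ (?rk {0..<n} - ?rk A) * 2 ^ ?rk A"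
    using * le by (simp flip: power_add)
  then show "card ?C = 2 ^ (?rk {0..<n} - ?rk A)"
    by simp
qed

section \<open>The weight enumerator of the triples\<close>

lemma sum_power_card_triples:
  fixes \<omega> :: "'a::comm_ring_1"
  assumes G: "G \<in> carrier_mat m n" and \<sigma>: "\<sigma> > 0" and root: "\<omega> ^ \<sigma> = 1"
  shows "(\<Sum>k = 0..<\<sigma>. \<omega> ^ k * of_nat (card (triples G k \<sigma>))) =
    (\<Sum>u\<in>row_space G. \<Sum>v\<in>row_space G. \<Sum>f\<in>carrier_vec n.
      \<omega> ^ (card (supp (f + u)) + card (supp f) + card (supp (f + v))))"
proof -
  let ?V = "carrier_vec n :: bit vec set"
  define wt :: "bit vec \<times> bit vec \<times> bit vec \<Rightarrow> nat"
    where "wt = (\<lambda>(f1, f2, f3). card (supp f1) + card (supp f2) + card (supp f3))"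
  \<comment> \<open>The triples without the congruence; the residues of \<open>wt\<close> modulo
    \<open>\<sigma>\<close> partition them.\<close>
  define T where "T = {(f1, f2, f3). f1 \<in> ?V \<and> f2 \<in> ?V \<and> f3 \<in> ?V \<and>
    f1 - f2 \<in> row_space G \<and> f2 - f3 \<in> row_space G}"
  have "finite (?V \<times> ?V \<times> ?V)"
    by (simp add: finite_carrier_vec_bit)
  then have finT: "finite T"
    by (rule finite_subset[rotated]) (auto simp: T_def)
  have triples: "triples G k \<sigma> = {t \<in> T. wt t mod \<sigma> = k}" if "k < \<sigma>" for k
    using G that by (auto simp: triples_def T_def wt_def cong_def)
  have power_mod: "\<omega> ^ (j mod \<sigma>) = \<omega> ^ j" for j
  proof -
    have "\<omega> ^ j = \<omega> ^ (\<sigma> * (j div \<sigma>) + j mod \<sigma>)"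
      by simp
    also have "\<dots> = \<omega> ^ (j mod \<sigma>)"
      by (simp only: power_add power_mult root power_one mult_1)
    finally show ?thesis ..
  qed
  have "(\<Sum>k = 0..<\<sigma>. \<omega> ^ k * of_nat (card (triples G k \<sigma>))) =
      (\<Sum>k = 0..<\<sigma>. \<Sum>t\<in>{t \<in> T. wt t mod \<sigma> = k}. \<omega> ^ wt t)"
  proof (rule sum.cong[OF refl])
    fix k assume "k \<in> {0..<\<sigma>}"
    then have "\<omega> ^ k * of_nat (card (triples G k \<sigma>)) = (\<Sum>t\<in>{t \<in> T. wt t mod \<sigma> = k}. \<omega> ^ k)"
      by (simp add: triples mult.commute)
    also have "\<dots> = (\<Sum>t\<in>{t \<in> T. wt t mod \<sigma> = k}. \<omega> ^ wt t)"
      by (intro sum.cong) (auto simp: power_mod)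
    finally show "\<omega> ^ k * of_nat (card (triples G k \<sigma>)) = \<dots>" .
  qed
  also have "\<dots> = (\<Sum>t\<in>T. \<omega> ^ wt t)"
    using finT \<sigma> by (intro sum.group) auto
  \<comment> \<open>A triple is determined by its middle function and the two differences; signs do
    not matter in characteristic 2, so the third function is \<open>f + v\<close> although
    \<open>v\<close> is \<open>f2 - f3\<close>.\<close>
  also have "\<dots> = (\<Sum>(u, v, f)\<in>row_space G \<times> row_space G \<times> ?V. \<omega> ^ wt (f + u, f, f + v))"
  proof (rule sum.reindex_bij_witness[where
        i = "\<lambda>(u, v, f). (f + u, f, f + v)" and j = "\<lambda>(f1, f2, f3). (f1 - f2, f2 - f3, f2)"])
    have R: "w \<in> carrier_vec n" if "w \<in> row_space G" for w
      using that G vec_space.row_space_eq[of G m "dim_col G"] by auto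
    have add_minus: "f + w - f = w" "f - (f + w) = w"
      if "f \<in> ?V" "w \<in> ?V" for f w :: "bit vec"
    proof -
      have "(a :: bit) + b - a = b" "a - (a + b) = b" for a b
        by (cases a; cases b; simp)+
      then show "f + w - f = w" "f - (f + w) = w"
        using that by (auto simp: vec_eq_iff)
    qed
    have minus_add: "g + (f - g) = f" "g + (g - f) = f"
      if "f \<in> ?V" "g \<in> ?V" for f g :: "bit vec"
    proof -
      have "(a :: bit) + (b - a) = b" "a + (a - b) = b" for a b
        by (cases a; cases b; simp)+
      then show "g + (f - g) = f" "g + (g - f) = f"
        using that by (auto simp: vec_eq_iff)
    qed
    fix a :: "bit vec \<times> bit vec \<times> bit vec"
    show "a \<in> T \<Longrightarrow> (\<lambda>(u, v, f). (f + u, f, f + v)) ((\<lambda>(f1, f2, f3). (f1 - f2, f2 - f3, f2)) a) = a"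
      by (auto simp: T_def minus_add)
    show "a \<in> T \<Longrightarrow> (\<lambda>(f1, f2, f3). (f1 - f2, f2 - f3, f2)) a \<in> row_space G \<times> row_space G \<times> ?V"
      by (auto simp: T_def)
    show "a \<in> row_space G \<times> row_space G \<times> ?V \<Longrightarrow>
        (\<lambda>(f1, f2, f3). (f1 - f2, f2 - f3, f2)) ((\<lambda>(u, v, f). (f + u, f, f + v)) a) = a"
      using R by (auto simp: add_minus)
    show "a \<in> row_space G \<times> row_space G \<times> ?V \<Longrightarrow> (\<lambda>(u, v, f). (f + u, f, f + v)) a \<in> T"
      using R by (auto simp: T_def add_minus)
    show "a \<in> T \<Longrightarrow> (case (\<lambda>(f1, f2, f3). (f1 - f2, f2 - f3, f2)) a of
        (u, v, f) \<Rightarrow> \<omega> ^ wt (f + u, f, f + v)) = \<omega> ^ wt a"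
      by (auto simp: T_def minus_add)
  qed
  finally show ?thesis
    by (simp add: sum.cartesian_product' wt_def)
qed

text \<open>The indicators for \<open>u\<close> and \<open>v\<close> stay separate factors so that a
  later double sum over the row space splits.\<close>

lemma sum_carrier_vec_weight:
  fixes x :: "'a::comm_ring_1" and u v :: "bit vec"
  assumes u: "u \<in> carrier_vec n" and v: "v \<in> carrier_vec n"
  shows "(\<Sum>f\<in>carrier_vec n. x ^ (card (supp (f + u)) + card (supp f) + card (supp (f + v)))) =
    (1 + x) ^ n * (\<Sum>A\<in>Pow {0..<n}. x ^ (n - card A) * (1 - x) ^ (2 * card A) *
      (of_bool (\<forall>e\<in>A. u $ e = 0) * of_bool (\<forall>e\<in>A. v $ e = 0)))"
proof -
  define w where "w b = (if b = 0 then 1 else x)" for b :: bit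
  \<comment> \<open>Chosen so that both local factors, 1 + x^3 and x + x^2, take the form
    \<open>(1 + x) * (h e + x)\<close>; the sets \<open>A\<close> then record where
    \<open>h e\<close> is picked in the expansion.\<close>
  define h where "h e = (1 - x)\<^sup>2 * (of_bool (u $ e = 0) * of_bool (v $ e = 0))" for e
  have "(\<Sum>f\<in>carrier_vec n. x ^ (card (supp (f + u)) + card (supp f) + card (supp (f + v)))) =
      (\<Sum>f\<in>carrier_vec n. \<Prod>e = 0..<n. w (f $ e + u $ e) * w (f $ e) * w (f $ e + v $ e))"
    using u v by (intro sum.cong) (auto simp: power_add card_supp_power[of _ n] w_def prod.distrib)
  also have "\<dots> = (\<Prod>e = 0..<n. w (u $ e) * w (v $ e) + w (1 + u $ e) * x * w (1 + v $ e))"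
    by (subst sum_carrier_vec_prod) (simp add: w_def)
  also have "\<dots> = (\<Prod>e = 0..<n. (1 + x) * (h e + x))"
  proof (rule prod.cong[OF refl])
    fix e
    show "w (u $ e) * w (v $ e) + w (1 + u $ e) * x * w (1 + v $ e) = (1 + x) * (h e + x)"
      by (cases "u $ e"; cases "v $ e")
        (simp_all add: w_def h_def power2_eq_square algebra_simps)
  qed
  also have "\<dots> = (1 + x) ^ n * (\<Sum>A\<in>Pow {0..<n}. prod h A * x ^ card ({0..<n} - A))"
    by (simp add: prod.distrib prod_add)
  also have "(\<Sum>A\<in>Pow {0..<n}. prod h A * x ^ card ({0..<n} - A)) =
      (\<Sum>A\<in>Pow {0..<n}. x ^ (n - card A) * (1 - x) ^ (2 * card A) *
        (of_bool (\<forall>e\<in>A. u $ e = 0) * of_bool (\<forall>e\<in>A. v $ e = 0)))"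
  proof (rule sum.cong[OF refl])
    fix A assume A: "A \<in> Pow {0..<n}"
    then have fin: "finite A"
      using finite_subset by auto
    then have "(\<Prod>e\<in>A. of_bool (y $ e = 0)) = (of_bool (\<forall>e\<in>A. y $ e = 0) :: 'a)" for y :: "bit vec"
      by (induction A rule: finite_induct) auto
    then have "prod h A = (1 - x) ^ (2 * card A) *
        (of_bool (\<forall>e\<in>A. u $ e = 0) * of_bool (\<forall>e\<in>A. v $ e = 0))"
      unfolding h_def prod.distrib by (simp add: power_mult)
    then show "prod h A * x ^ card ({0..<n} - A) = x ^ (n - card A) * (1 - x) ^ (2 * card A) *
        (of_bool (\<forall>e\<in>A. u $ e = 0) * of_bool (\<forall>e\<in>A. v $ e = 0))"
      using A fin by (simp add: card_Diff_subset mult_ac)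
  qed
  finally show ?thesis .
qed

text \<open>For fixed \<open>A\<close> the double sum over \<open>u\<close> and \<open>v\<close> is
  the square of the number of codewords vanishing on \<open>A\<close>, which turns the base 2 into
  4.\<close>

lemma sum_power_card_triples_expansion:
  fixes \<omega> :: "'a::comm_ring_1"
  assumes G: "G \<in> carrier_mat m n" and \<sigma>: "\<sigma> > 0" and root: "\<omega> ^ \<sigma> = 1"
  shows "(\<Sum>k = 0..<\<sigma>. \<omega> ^ k * of_nat (card (triples G k \<sigma>))) =
    (1 + \<omega>) ^ n * (\<Sum>A\<in>Pow {0..<n}. \<omega> ^ (n - card A) * (1 - \<omega>) ^ (2 * card A) *
      4 ^ (matroid_rank (column_matroid G) {0..<n} - matroid_rank (column_matroid G) A))"
proof -
  define z :: "nat set \<Rightarrow> bit vec \<Rightarrow> 'a" where "z A u = of_bool (\<forall>e\<in>A. u $ e = 0)" for A u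
  define p where "p A = \<omega> ^ (n - card A) * (1 - \<omega>) ^ (2 * card A)" for A :: "nat set"
  have R: "w \<in> carrier_vec n" if "w \<in> row_space G" for w
    using that G vec_space.row_space_eq[of G m "dim_col G"] by auto
  have finR: "finite (row_space G)"
    by (rule finite_subset[OF _ finite_carrier_vec_bit[of n]]) (use R in blast)
  have sum_z: "(\<Sum>u\<in>row_space G. z A u) =
      2 ^ (matroid_rank (column_matroid G) {0..<n} - matroid_rank (column_matroid G) A)"
    if "A \<subseteq> {0..<n}" for A
    using finR card_row_space_vanishing(2)[OF G that]
    by (simp add: z_def sum.If_cases of_bool_def Int_def)
  have "(\<Sum>k = 0..<\<sigma>. \<omega> ^ k * of_nat (card (triples G k \<sigma>))) =
      (\<Sum>u\<in>row_space G. \<Sum>v\<in>row_space G. (1 + \<omega>) ^ n * (\<Sum>A\<in>Pow {0..<n}. p A * (z A u * z A v)))"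
    unfolding sum_power_card_triples[OF assms] p_def z_def
    by (intro sum.cong refl sum_carrier_vec_weight R)
  also have "\<dots> = (1 + \<omega>) ^ n *
      (\<Sum>A\<in>Pow {0..<n}. \<Sum>u\<in>row_space G. \<Sum>v\<in>row_space G. p A * (z A u * z A v))"
    by (simp only: sum.swap[of _ "Pow {0..<n}"] flip: sum_distrib_left)
  also have "\<dots> = (1 + \<omega>) ^ n *
      (\<Sum>A\<in>Pow {0..<n}. p A * ((\<Sum>u\<in>row_space G. z A u) * (\<Sum>v\<in>row_space G. z A v)))"
    unfolding sum_product by (simp only: sum_distrib_left)
  also have "(\<Sum>A\<in>Pow {0..<n}. p A * ((\<Sum>u\<in>row_space G. z A u) * (\<Sum>v\<in>row_space G. z A v))) =
      (\<Sum>A\<in>Pow {0..<n}. p A *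
        4 ^ (matroid_rank (column_matroid G) {0..<n} - matroid_rank (column_matroid G) A))"
    by (intro sum.cong) (auto simp: sum_z simp flip: power_mult_distrib)
  finally show ?thesis
    by (simp add: p_def)
qed

section \<open>Comparison with the rank generating polynomial at a root of unity\<close>

theorem theorem5p2:
  fixes \<sigma> :: nat and \<rho> :: int and \<theta> :: real and \<omega> :: complex
    and G :: "bit mat" and m n r :: nat
  assumes "\<sigma> > 2"
    and "coprime \<rho> (int \<sigma>)"
    and "\<theta> = 2 * of_int \<rho> * pi / of_nat \<sigma>"
    and "\<omega> = exp (\<i> * of_real \<theta>)"
    and "G \<in> carrier_mat m n"
    and "vec_space.rank m G = r"
  shows "(\<Sum>k = 0..<\<sigma>. \<omega> ^ k * of_nat (card (triples G k \<sigma>))) =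
    \<omega> ^ (n - r) * (1 + \<omega>) ^ n * (1 - \<omega>) ^ (2 * r) *
    of_real (rank_generating (column_matroid G) (2 / (cos \<theta> - 1)) (2 * (cos \<theta> - 1)))"
proof -
  let ?rk = "matroid_rank (column_matroid G)"
  have \<sigma>: "\<sigma> > 0"
    using assms(1) by simp
  have \<omega>: "\<omega> = cis \<theta>"
    by (simp add: assms(4) cis_conv_exp)
  have "\<omega> ^ \<sigma> = cis (of_nat \<sigma> * \<theta>)"
    unfolding \<omega> by (rule Complex.DeMoivre)
  also have "of_nat \<sigma> * \<theta> = 2 * pi * of_int \<rho>"
    using \<sigma> by (simp add: assms(3) field_simps)
  also have "cis \<dots> = 1"
    by (rule cis_multiple_2pi) simp
  finally have root: "\<omega> ^ \<sigma> = 1" .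
  \<comment> \<open>Otherwise \<open>\<sigma>\<close> divides \<open>\<rho>\<close>, which
    coprimality allows only for a unit. This makes the denominator of the first argument
    nonzero.\<close>
  have cos_ne: "cos \<theta> \<noteq> 1"
  proof
    assume "cos \<theta> = 1"
    then obtain j :: int where "\<theta> = of_int j * (2 * pi)"
      using cos_one_2pi_int by auto
    then have "of_int \<rho> = (of_int (j * int \<sigma>) :: real)"
      using \<sigma> assms(3) by (simp add: field_simps)
    then have "\<rho> = j * int \<sigma>"
      by (simp only: of_int_eq_iff)
    then have "is_unit (int \<sigma>)"
      using assms(2) by simp
    then show False
      using assms(1) by simp
  qed
  \<comment> \<open>The second argument of the polynomial; the first is then 4 / c, which supplies
    the powers of 4.\<close>
  define c :: complex where "c = of_real (2 * (cos \<theta> - 1))"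
  have c0: "c \<noteq> 0"
    using cos_ne by (simp add: c_def)
  have "(sin \<theta>)\<^sup>2 = 1 - (cos \<theta>)\<^sup>2"
    by (rule sin_squared_eq)
  \<comment> \<open>Since \<open>\<omega>\<close> lies on the unit circle, \<omega> + 1/\<omega> = 2
    cos \<theta>.\<close>
  then have c: "\<omega> * c = (1 - \<omega>)\<^sup>2"
    by (simp add: \<omega> c_def complex_eq_iff power2_eq_square algebra_simps)
  have l: "complex_of_real (2 / (cos \<theta> - 1)) = 4 / of_real (2 * (cos \<theta> - 1))"
    using cos_ne by (simp add: field_simps)
  have r: "r = ?rk {0..<n}"
    using assms(6) matroid_rank_column_matroid[OF assms(5)] by simp
  have rn: "r \<le> n"
    using matroid_rank_column_matroid_le_card[OF assms(5) order.refl] by (simp add: r)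
  have "(\<Sum>A\<in>Pow {0..<n}. \<omega> ^ (n - card A) * (1 - \<omega>) ^ (2 * card A) * 4 ^ (r - ?rk A)) =
      (\<Sum>A\<in>Pow {0..<n}. \<omega> ^ (n - r) * (1 - \<omega>) ^ (2 * r) * ((4 / c) ^ (r - ?rk A) * c ^ (card A - ?rk A)))"
  proof (rule sum.cong[OF refl])
    fix A assume "A \<in> Pow {0..<n}"
    then have A: "A \<subseteq> {0..<n}" by simp
    \<comment> \<open>Additive decompositions replace the natural subtractions in the
      exponents.\<close>
    obtain i where i: "r = ?rk A + i"
      using card_row_space_vanishing(1)[OF assms(5) A] r le_Suc_ex by blast
    obtain j where j: "card A = ?rk A + j"
      using matroid_rank_column_matroid_le_card[OF assms(5) A] le_Suc_ex by blast
    obtain d where d: "n = r + d"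
      using rn le_Suc_ex by blast
    have "card A \<le> n"
      using A card_mono[of "{0..<n}" A] by simp
    then obtain k where k: "n = card A + k"
      using le_Suc_ex by blast
    have "i + d = j + k"
      using i j d k by simp
    then have "\<omega> ^ k * \<omega> ^ j = \<omega> ^ d * \<omega> ^ i"
      by (simp add: add.commute flip: power_add)
    \<comment> \<open>On both sides \<open>\<omega>\<close> has total exponent \<open>n\<close>, and
      \<open>c\<close> has total exponent \<open>card A\<close> once the \<open>i\<close> powers in
      the denominator are cancelled.\<close>
    then have "\<omega> ^ k * (\<omega> * c) ^ card A * 4 ^ i =
        \<omega> ^ d * (\<omega> * c) ^ r * ((4 / c) ^ i * c ^ j)"
      using c0 by (simp add: i j power_add power_mult_distrib power_divide field_simps)
    then show "\<omega> ^ (n - card A) * (1 - \<omega>) ^ (2 * card A) * 4 ^ (r - ?rk A) =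
        \<omega> ^ (n - r) * (1 - \<omega>) ^ (2 * r) * ((4 / c) ^ (r - ?rk A) * c ^ (card A - ?rk A))"
      unfolding power_mult c[symmetric] using i j d k by simp
  qed
  moreover have "ground (column_matroid G) = {0..<n}"
    using assms(5) by (simp add: column_matroid_def)
  then have "of_real (rank_generating (column_matroid G) (2 / (cos \<theta> - 1)) (2 * (cos \<theta> - 1))) =
      (\<Sum>A\<in>Pow {0..<n}. (4 / c) ^ (r - ?rk A) * c ^ (card A - ?rk A))"
    unfolding c_def l[symmetric] by (simp add: rank_generating_def r)
  ultimately show ?thesis
    unfolding sum_power_card_triples_expansion[OF assms(5) \<sigma> root] r[symmetric]
    by (simp only: sum_distrib_left mult_ac)
qed

end
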